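(* Let $G$ be a nontrivial cyclic group of order $n$, let $S$ be the set of all generators of $G$, and let $\Gamma(G)$ be the generator graph of $G$. Then the Sombor index of $\Gamma(G)$ is $$SO(\Gamma(G)) = \tfrac{\sqrt{2}}{2}|S|(|S|-1)(n-1) + |S|(n-|S|)\sqrt{(n-1)^2+|S|^2}.$$
   Context: For a group $G$, the generator graph $\Gamma(G)$ is the simple undirected graph whose vertex set is the set of elements of $G$, in which two distinct elements $x,y$ are adjacent if and only if at least one of them generates $G$ (i.e. $\langle x\rangle = G$ or $\langle y\rangle = G$). For a graph $\Gamma$, the Sombor index is $SO(\Gamma) = \sum_{uv\in E(\Gamma)} \sqrt{\deg_\Gamma(u)^2+\deg_\Gamma(v)^2}$. *)

theory Defs
  imports Complex_Main "HOL-Algebra.Elementary_Groups"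
begin

record 'a ugraph =
  vertices :: "'a set"
  edges :: "'a set set"

definition simple_graph :: "'a ugraph \<Rightarrow> bool" where
  "simple_graph \<Gamma> \<longleftrightarrow> (\<forall>e\<in>edges \<Gamma>. e \<subseteq> vertices \<Gamma> \<and> card e = 2)"

definition deg :: "'a ugraph \<Rightarrow> 'a \<Rightarrow> nat" where
  "deg \<Gamma> v = card {e \<in> edges \<Gamma>. v \<in> e}"

text \<open>An edge is an unordered pair, so each edge contributes once, and the inner sum
  runs over its two endpoints (see \<open>edge_weight\<close> below).
  Meaningful for finite simple graphs only.\<close>

definition sombor_index :: "'a ugraph \<Rightarrow> real" where
  "sombor_index \<Gamma> = (\<Sum>e\<in>edges \<Gamma>. sqrt (\<Sum>v\<in>e. (real (deg \<Gamma> v))\<^sup>2))"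

definition generators :: "('a, 'b) monoid_scheme \<Rightarrow> 'a set" where
  "generators G = {x \<in> carrier G. generate G {x} = carrier G}"

definition generator_graph :: "('a, 'b) monoid_scheme \<Rightarrow> 'a ugraph" where
  "generator_graph G =
     \<lparr> vertices = carrier G,
       edges = {{x, y} | x y. x \<in> carrier G \<and> y \<in> carrier G \<and> x \<noteq> y \<and>
                              (generate G {x} = carrier G \<or> generate G {y} = carrier G)} \<rparr>"

lemma edge_weight:
  "u \<noteq> v \<Longrightarrow> sqrt (\<Sum>w\<in>{u, v}. (real (deg \<Gamma> w))\<^sup>2) = sqrt ((real (deg \<Gamma> u))\<^sup>2 + (real (deg \<Gamma> v))\<^sup>2)"
  by simp

lemma simple_graph_generator_graph: "simple_graph (generator_graph G)"
  by (auto simp: simple_graph_def generator_graph_def)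

lemma generator_graph_adjacent_iff:
  assumes "x \<in> carrier G" "y \<in> carrier G"
  shows "{x, y} \<in> edges (generator_graph G) \<longleftrightarrow>
         x \<noteq> y \<and> (generate G {x} = carrier G \<or> generate G {y} = carrier G)"
  using assms by (auto simp: generator_graph_def doubleton_eq_iff)

end

theory Submission
  imports Defs
begin

text \<open>Only the partition of the edges matters: writing \<open>S\<close> for the set of generators, an
  edge either lies inside \<open>S\<close> or joins \<open>S\<close> to its complement. Generators are adjacent to every
  other vertex, non-generators exactly to \<open>S\<close>, so the edge weight is constant on each part.\<close>

lemma edges_generator_graph_partition:
  fixes G (structure)
  defines "S \<equiv> generators G"
  shows "edges (generator_graph G) =
           {e. e \<subseteq> S \<and> card e = 2} \<union> (\<lambda>(x, y). {x, y}) ` (S \<times> (carrier G - S))"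
    (is "?E = ?A \<union> ?B")
proof
  show "?E \<subseteq> ?A \<union> ?B"
  proof
    fix e assume "e \<in> ?E"
    then obtain x y where e: "e = {x, y}" "x \<in> carrier G" "y \<in> carrier G" "x \<noteq> y"
      and "x \<in> S \<or> y \<in> S"
      by (auto simp: generator_graph_def S_def generators_def)
    then consider "x \<in> S" "y \<in> S" | "x \<in> S" "y \<notin> S" | "x \<notin> S" "y \<in> S"
      by blast
    then show "e \<in> ?A \<union> ?B"
    proof cases
      case 1
      then show ?thesis using e by simp
    next
      case 2
      then have "e \<in> ?B" using e by (intro image_eqI[of _ _ "(x, y)"]) auto
      then show ?thesis ..
    next
      \<comment> \<open>The product lists the generator first, so the witness pair has its entries
        swapped.\<close>
      case 3
      then have "e \<in> ?B" using e by (intro image_eqI[of _ _ "(y, x)"]) auto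
      then show ?thesis ..
    qed
  qed
  show "?A \<union> ?B \<subseteq> ?E"
  proof
    fix e assume "e \<in> ?A \<union> ?B"
    then obtain x y where "e = {x, y}" "x \<in> S" "y \<in> carrier G" "x \<noteq> y"
      by (auto simp: card_2_iff S_def generators_def)
    then show "e \<in> ?E"
      by (auto simp: generator_graph_adjacent_iff S_def generators_def)
  qed
qed

text \<open>An edge at \<open>v\<close> has exactly one other endpoint, and \<open>w\<close> can be
  recovered from \<open>{v, w}\<close>, so neighbours correspond bijectively to incident
  edges.\<close>

lemma deg_eq_card_neighbours:
  assumes "simple_graph \<Gamma>"
  shows "deg \<Gamma> v = card {w. {v, w} \<in> edges \<Gamma>}"
proof -
  have "\<exists>w. e = {v, w}" if "e \<in> edges \<Gamma>" "v \<in> e" for e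
  proof -
    have "card e = 2" using assms that by (simp add: simple_graph_def)
    then show ?thesis using that(2) by (auto simp: card_2_iff)
  qed
  then have "{e \<in> edges \<Gamma>. v \<in> e} = (\<lambda>w. {v, w}) ` {w. {v, w} \<in> edges \<Gamma>}"
    by auto
  moreover have "inj (\<lambda>w. {v, w})"
    by (auto simp: inj_def doubleton_eq_iff)
  ultimately show ?thesis
    by (simp add: deg_def card_image inj_on_subset)
qed

lemma deg_generator_graph:
  assumes "v \<in> carrier G"
  shows "deg (generator_graph G) v =
           (if v \<in> generators G then order G - 1 else card (generators G))"
proof -
  have "{w. {v, w} \<in> edges (generator_graph G)} =
          (if v \<in> generators G then carrier G - {v} else generators G)"
    using assms by (auto simp: generator_graph_def generators_def doubleton_eq_iff)
  then show ?thesis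
    using assms
    by (simp add: deg_eq_card_neighbours[OF simple_graph_generator_graph] order_def card_Diff_singleton)
qed

text \<open>Turns the number of edges inside \<open>S\<close> into the real polynomial of the final
  formula. Splitting on \<open>k\<close> removes the truncated \<open>k - 1\<close> of
  \<open>choose_two\<close>.\<close>

lemma real_choose_two: "real (k choose 2) = real k * (real k - 1) / 2"
  by (cases k) (simp_all add: choose_two real_of_nat_div algebra_simps)

theorem theorem4p9:
  fixes G :: "('a, 'b) monoid_scheme" and n :: nat and S :: "'a set"
  assumes "group G"
    and "cyclic_group G"
    and "\<not> trivial_group G"
    and "finite (carrier G)"
    and "order G = n"
    and "S = generators G"
  shows "sombor_index (generator_graph G) =
           sqrt 2 / 2 * real (card S) * (real (card S) - 1) * (real n - 1)
           + real (card S) * (real n - real (card S)) * sqrt ((real n - 1)\<^sup>2 + (real (card S))\<^sup>2)"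
proof -
  interpret group G by fact
  define w where "w e = sqrt (\<Sum>v\<in>e. (real (deg (generator_graph G) v))\<^sup>2)" for e
  define A where "A = {e. e \<subseteq> S \<and> card e = 2}"
  let ?P = "S \<times> (carrier G - S)"
  have S: "S \<subseteq> carrier G" "finite S"
    using assms(4,6) by (auto simp: generators_def)
  \<comment> \<open>A finite group has at least one element, so the subtraction on naturals does not
    truncate.\<close>
  have n: "real (n - 1) = real n - 1"
    using assms(4,5) order_gt_0_iff_finite by (simp add: of_nat_diff Suc_leI)
  have deg_in: "real (deg (generator_graph G) v) = real n - 1" if "v \<in> S" for v
    using that S assms(5,6) n by (auto simp: deg_generator_graph)
  have deg_out: "real (deg (generator_graph G) v) = real (card S)" if "v \<in> carrier G - S" for v
    using that assms(6) by (simp add: deg_generator_graph)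
  have wA: "w e = sqrt 2 * (real n - 1)" if "e \<in> A" for e
  proof -
    have "(\<Sum>v\<in>e. (real (deg (generator_graph G) v))\<^sup>2) = (\<Sum>v\<in>e. (real n - 1)\<^sup>2)"
      using that by (intro sum.cong) (auto simp: A_def deg_in)
    also have "\<dots> = 2 * (real n - 1)\<^sup>2"
      using that by (simp add: A_def)
    \<comment> \<open>Rewriting \<open>real n - 1\<close> back to \<open>real (n - 1)\<close> makes
      it visibly nonnegative, so the root of its square is the number itself and not an absolute
      value.\<close>
    finally show ?thesis
      by (simp add: w_def real_sqrt_mult flip: n)
  qed
  have wB: "w {x, y} = sqrt ((real n - 1)\<^sup>2 + (real (card S))\<^sup>2)"
    if "x \<in> S" "y \<in> carrier G - S" for x y
  proof -
    have "x \<noteq> y" using that by auto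
    then show ?thesis using that by (simp add: w_def deg_in deg_out)
  qed
  \<comment> \<open>Exactly one endpoint lies in \<open>S\<close>, which fixes the order of the
    pair.\<close>
  have inj: "inj_on (\<lambda>(x, y). {x, y}) ?P"
    by (auto simp: inj_on_def doubleton_eq_iff)
  have "sombor_index (generator_graph G) = sum w (A \<union> (\<lambda>(x, y). {x, y}) ` ?P)"
    by (simp add: sombor_index_def edges_generator_graph_partition A_def w_def assms(6))
  \<comment> \<open>The parts are disjoint: members of \<open>A\<close> stay inside
    \<open>S\<close>, while every mixed edge leaves it.\<close>
  also have "\<dots> = sum w A + sum w ((\<lambda>(x, y). {x, y}) ` ?P)"
    using S assms(4) by (intro sum.union_disjoint) (auto simp: A_def)
  also have "sum w A = real (card S choose 2) * (sqrt 2 * (real n - 1))"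
    using n_subsets[OF S(2), of 2] by (simp add: wA A_def[symmetric])
  also have "sum w ((\<lambda>(x, y). {x, y}) ` ?P) = (\<Sum>p\<in>?P. sqrt ((real n - 1)\<^sup>2 + (real (card S))\<^sup>2))"
    unfolding sum.reindex[OF inj] by (intro sum.cong) (auto simp: wB)
  also have "\<dots> = real (card S) * (real n - real (card S)) * sqrt ((real n - 1)\<^sup>2 + (real (card S))\<^sup>2)"
    \<comment> \<open>The bound \<open>card S\<close> \<le> \<open>n\<close> lets the size of the
      complement pass to a difference of reals.\<close>
    using S assms(5) card_mono[OF assms(4) S(1)]
    by (simp add: card_cartesian_product card_Diff_subset of_nat_diff order_def)
  finally show ?thesis
    by (simp add: real_choose_two)
qed

end
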